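(* Let $(X,\mu)$ be a measure space and $\mathbb{R}_+=(0,\infty)$. Let $K:X\times X\times\mathbb{R}_+\to[0,+\infty)$ be measurable with $$\int_X K(x,y;t)\,d\mu(y)=1\quad\text{for a.e. }x\in X,\ \text{a.e. }t\in\mathbb{R}_+ .$$ Let $g:X\times\mathbb{R}_+\to[0,+\infty)$ be measurable with $g\in L^\infty(X\times\mathbb{R}_+)$, and put $\beta=\|g\|_{L^\infty(X\times\mathbb{R}_+)}$. Let $h:X\times\mathbb{R}_+\to[0,+\infty)$ be measurable. Let $G:[0,+\infty)\to[0,+\infty)$ be continuous, strictly increasing and concave, with $G(0)=0$. Assume that there exist $p_1,p_2\in C(\mathbb{R}_+,\mathbb{R}_+)$ and $\xi>0$ such that (a) $p_1\not\equiv p_2$ and $\int_0^\infty p_2(t)\,dt=1$; (b) $p_1(t)\le h(x,t)\le p_2(t)$ for a.e. $x\in X$ and a.e. $t\in\mathbb{R}_+$; (c) $\xi-G(\xi)=\beta$. Then there exists $u\in L^\infty(X\times\mathbb{R}_+,[0,+\infty))$ satisfying the integral equation $$u(x,t)=g(x,t)+\int_0^t\int_X K(x,y;t-s)\,h(y,s)\,G(u(y,s))\,d\mu(y)\,ds .$$ Moreover, $u$ is the almost everywhere limit of the decreasing sequence $\{u_m\}_{m=1}^\infty$ of non-negative measurable functions given by the iterative approximations $$u_0(x,t)=\xi-\beta+g(x,t),$$ $$u_{m+1}(x,t)=g(x,t)+\int_0^t\int_X K(x,y;t-s)\,h(y,s)\,G(u_m(y,s))\,d\mu(y)\,ds,$$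 for all $m\in\{0\}\cup\mathbb{N}$, a.e. $x\in X$, a.e. $t\in\mathbb{R}_+$. If, in addition, (d) there exists $T_0>0$ such that $\inf_{(x,t)\in X\times(0,T_0)}g(x,t)=\beta_0>0$; (e) $\lim_{t\to0+}\frac{p_1(t)}{p_2(t)}>0$; (f) there exists a homeomorphism $\varphi:[0,1]\to[0,1]$ which is concave, with $\varphi(0)=0$ and $\varphi(1)=1$, such that $G(\sigma u)\ge\varphi(\sigma)G(u)$ for all $\sigma\in[0,1]$ and all $u\in[0,\xi]$, then there exist $C>0$ and $k\in(0,1)$ such that $$0\le u_{m+1}(x,t)-u(x,t)\le C\,k^m\quad\text{for a.e. }x\in X,\ \text{a.e. }t\in\mathbb{R}_+,\ \text{and all }m\in\mathbb{N}.$$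
   Context: $\mathbb{R}_+=(0,\infty)$ carries Lebesgue measure, and $X\times\mathbb{R}_+$ and $X\times X\times\mathbb{R}_+$ carry the corresponding product measures; "a.e." refers to these measures. $C(\mathbb{R}_+,\mathbb{R}_+)$ denotes continuous functions from $(0,\infty)$ to $(0,\infty)$. $L^\infty(X\times\mathbb{R}_+,[0,+\infty))$ denotes the essentially bounded measurable functions with values in $[0,+\infty)$. The integral equation is understood to hold for a.e. $x\in X$ and a.e. $t\in\mathbb{R}_+$.
   Formalization: The measure space (X,μ) is assumed σ-finite; without this the product measures are not well determined and the iterates u_m can fail to be measurable, so the claim as stated for arbitrary measure spaces is false. *)

theory Defs
  imports "HOL-Probability.Essential_Supremum"
begin

definition Rpos :: "real measure" where
  "Rpos = lebesgue_on {0<..}"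

text \<open>Since the essential supremum is taken in \<^typ>\<open>ennreal\<close>, the norm over a null space is 0
  and not $-\infty$.\<close>

definition Linf_norm :: "'b measure \<Rightarrow> ('b \<Rightarrow> real) \<Rightarrow> ennreal" where
  "Linf_norm N f = esssup N (\<lambda>z. ennreal \<bar>f z\<bar>)"

definition Linf_nonneg :: "'b measure \<Rightarrow> ('b \<Rightarrow> real) set" where
  "Linf_nonneg N = {f \<in> borel_measurable N. (\<forall>z\<in>space N. 0 \<le> f z) \<and> Linf_norm N f < \<infinity>}"

text \<open>The integrands are non-negative, so the double integral is taken in $[0,\infty]$; an equation
  \<open>ennreal r = volterra_rhs \<dots>\<close> therefore also asserts that it is finite. (The Bochner integral would
  silently be 0 for a divergent integral.)\<close>

definition volterra_rhs ::
  "'a measure \<Rightarrow> ('a \<times> 'a \<times> real \<Rightarrow> real) \<Rightarrow> ('a \<times> real \<Rightarrow> real) \<Rightarrow> (real \<Rightarrow> real)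
    \<Rightarrow> ('a \<times> real \<Rightarrow> real) \<Rightarrow> ('a \<times> real \<Rightarrow> real) \<Rightarrow> 'a \<Rightarrow> real \<Rightarrow> ennreal" where
  "volterra_rhs M K h G g u x t =
     ennreal (g (x, t)) +
     (\<integral>\<^sup>+s\<in>{0<..<t}. (\<integral>\<^sup>+y. ennreal (K (x, y, t - s) * h (y, s) * G (u (y, s))) \<partial>M) \<partial>lebesgue)"

end

theory Submission imports Defs begin

text \<open>
  On \<open>N = M \<Otimes>\<^sub>M Rpos\<close> the equation has the Hammerstein form
  \<open>u z = g z + \<integral> \<kappa> (z, w) * G (u w) dN\<close> with
  \<open>\<kappa> ((x, t), (y, s)) = K (x, y, t - s) * h (y, s)\<close> for \<open>s < t\<close> and \<open>0\<close> otherwise. Since \<open>K\<close> has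
  mass \<open>1\<close> in \<open>y\<close> and \<open>h \<le> p2\<close> with \<open>\<integral> p2 = 1\<close>, the kernel \<open>\<kappa>\<close> has mass at most \<open>1\<close>; because
  \<open>\<xi> = \<beta> + G \<xi>\<close>, the right-hand side maps functions bounded by \<open>\<xi>\<close> below \<open>G \<xi> + g = U 0\<close>.
  As it is monotone, the iterates decrease (\<open>U_bounds\<close>), and dominated convergence shows
  that their limit is a solution (\<open>u_fixpoint\<close>).

  The rate (\<open>geometric_rate\<close>) rests on relative errors. If \<open>(1 - \<epsilon> w) * U m w \<le> u w\<close> for all \<open>w\<close>, then
  concavity of \<open>G\<close> gives \<open>(1 - \<epsilon> w) * G (U m w) \<le> G (u w)\<close>, so one application of the integral operator
  does not enlarge a constant relative error \<open>\<epsilon>\<close>. It shrinks it for \<open>t < T0\<close>, where the positive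
  error-free term \<open>g\<close> makes up a fixed fraction of the iterate. For \<open>t \<ge> T0\<close> a fixed fraction of
  the integral comes from times before \<open>T0\<close>, since \<open>h \<ge> p1 > 0\<close> there. So the error stays below a
  multiple of \<open>k ^ m\<close> when it is weighted by \<open>1/2\<close> for \<open>t < T0\<close> and by \<open>1\<close> afterwards.

  A measurability problem has to be removed first: \<open>K\<close> is measurable in time only for Lebesgue sets, and
  \<open>(t, s) \<mapsto> t - s\<close> is not measurable from the product of two Lebesgue \<open>\<sigma>\<close>-algebras to Lebesgue sets.
  Up to a null set of times, however, \<open>K\<close> is Borel in time (\<open>completion_second_factor_regularize\<close>), and
  for fixed \<open>t\<close> only a null set of \<open>s\<close> puts \<open>t - s\<close> into that set.
\<close>

section \<open>Monotone iteration for Hammerstein equations\<close>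

text \<open>A kernel of mass at most \<open>1\<close> and a free term bounded by \<open>\<beta> = \<xi> - G \<xi>\<close>: the constant \<open>\<xi>\<close> is a
  supersolution.\<close>

locale hammerstein = sigma_finite_measure N
  for N :: "'b measure" +
  fixes \<kappa> :: "'b \<times> 'b \<Rightarrow> ennreal" and g :: "'b \<Rightarrow> real" and G :: "real \<Rightarrow> real" and \<beta> \<xi> :: real
  assumes kernel_measurable [measurable]: "\<kappa> \<in> borel_measurable (N \<Otimes>\<^sub>M N)"
    and kernel_mass: "AE z in N. (\<integral>\<^sup>+w. \<kappa> (z, w) \<partial>N) \<le> 1"
    and g_measurable [measurable]: "g \<in> borel_measurable N"
    and g_nonneg: "\<And>z. z \<in> space N \<Longrightarrow> 0 \<le> g z"
    and g_le: "AE z in N. g z \<le> \<beta>"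
    and G_nonneg: "\<And>v. 0 \<le> v \<Longrightarrow> 0 \<le> G v"
    and G_cont: "continuous_on {0..} G"
    and G_mono: "mono_on {0..} G"
    and \<xi>_nonneg: "0 \<le> \<xi>"
    and balance: "\<xi> - G \<xi> = \<beta>"
begin

text \<open>The right-hand side of the equation, with values in \<open>[0, \<infinity>]\<close>.\<close>

definition T :: "('b \<Rightarrow> real) \<Rightarrow> 'b \<Rightarrow> ennreal" where
  "T u z = ennreal (g z) + (\<integral>\<^sup>+w. \<kappa> (z, w) * ennreal (G (u w)) \<partial>N)"

text \<open>Non-negativity is required at every point and not only almost everywhere, as \<open>G\<close> is arbitrary on
  negative arguments.\<close>

definition nonneg_fun :: "('b \<Rightarrow> real) \<Rightarrow> bool" where
  "nonneg_fun u \<longleftrightarrow> u \<in> borel_measurable N \<and> (\<forall>z\<in>space N. 0 \<le> u z)"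

lemma nonneg_funD:
  assumes "nonneg_fun u"
  shows "u \<in> borel_measurable N" "z \<in> space N \<Longrightarrow> 0 \<le> u z"
  using assms by (auto simp: nonneg_fun_def)

lemma G_comp_measurable:
  assumes "nonneg_fun u"
  shows "(\<lambda>w. G (u w)) \<in> borel_measurable N"
proof -
  have "continuous_on UNIV (\<lambda>v. G (max 0 v))"
    by (intro continuous_on_compose2[OF G_cont]) (auto intro!: continuous_intros)
  then have "(\<lambda>v. G (max 0 v)) \<in> borel_measurable borel"
    by (rule borel_measurable_continuous_onI)
  then have "(\<lambda>w. G (max 0 (u w))) \<in> borel_measurable N"
    using nonneg_funD(1)[OF assms] by (rule measurable_compose[rotated])
  then show ?thesis
    by (rule subst[OF measurable_cong, rotated]) (use nonneg_funD(2)[OF assms] in \<open>auto simp: max_def\<close>)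
qed

lemma T_measurable:
  assumes "nonneg_fun u"
  shows "T u \<in> borel_measurable N"
proof -
  note [measurable] = G_comp_measurable[OF assms]
  show ?thesis unfolding T_def[abs_def] by measurable
qed

lemma T_mono:
  assumes "nonneg_fun u" "nonneg_fun v" "AE w in N. u w \<le> v w"
  shows "T u z \<le> T v z"
proof -
  have "AE w in N. \<kappa> (z, w) * ennreal (G (u w)) \<le> \<kappa> (z, w) * ennreal (G (v w))"
    using assms(3) AE_space
    by eventually_elim
      (auto intro!: mult_left_mono ennreal_leI mono_onD[OF G_mono] nonneg_funD[OF assms(1)] nonneg_funD[OF assms(2)])
  then show ?thesis
    unfolding T_def by (intro add_left_mono nn_integral_mono_AE)
qed

lemma integral_bound:
  assumes "nonneg_fun u" "AE w in N. u w \<le> \<xi>"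
  shows "AE z in N. (\<integral>\<^sup>+w. \<kappa> (z, w) * ennreal (G (u w)) \<partial>N) \<le> ennreal (\<xi> - \<beta>)"
  using kernel_mass AE_space
proof eventually_elim
  case (elim z)
  have "AE w in N. \<kappa> (z, w) * ennreal (G (u w)) \<le> \<kappa> (z, w) * ennreal (G \<xi>)"
    using assms(2) AE_space
    by eventually_elim
      (auto intro!: mult_left_mono ennreal_leI mono_onD[OF G_mono] nonneg_funD[OF assms(1)] \<xi>_nonneg)
  then have "(\<integral>\<^sup>+w. \<kappa> (z, w) * ennreal (G (u w)) \<partial>N) \<le> (\<integral>\<^sup>+w. \<kappa> (z, w) * ennreal (G \<xi>) \<partial>N)"
    by (rule nn_integral_mono_AE)
  also have "\<dots> = (\<integral>\<^sup>+w. \<kappa> (z, w) \<partial>N) * ennreal (G \<xi>)"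
    using elim(2) by (intro nn_integral_multc) measurable
  also have "\<dots> \<le> 1 * ennreal (G \<xi>)"
    using elim(1) by (intro mult_right_mono) auto
  finally show ?case using balance by (simp add: algebra_simps flip: balance)
qed

text \<open>An iterate is set to \<open>0\<close> where the right-hand side is infinite; by \<open>U_bounds\<close> this happens
  only on a null set.\<close>

primrec U :: "nat \<Rightarrow> 'b \<Rightarrow> real" where
  "U 0 = (\<lambda>z. \<xi> - \<beta> + g z)"
| "U (Suc m) = (\<lambda>z. enn2real (T (U m) z))"

text \<open>The solution, defined as an infimum so that it is measurable and non-negative also at the points
  where the iterates fail to decrease.\<close>

definition u :: "'b \<Rightarrow> real" where
  "u z = (INF m. U m z)"

lemma \<beta>_le_\<xi>: "0 \<le> \<xi> - \<beta>" "\<beta> \<le> \<xi>"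
  using G_nonneg[OF \<xi>_nonneg] by (simp_all flip: balance)

lemma U_nonneg_fun: "nonneg_fun (U m)"
proof (induction m)
  case 0
  then show ?case using \<beta>_le_\<xi> g_nonneg by (auto simp: nonneg_fun_def)
next
  case (Suc m)
  then show ?case using T_measurable[OF Suc] by (auto simp: nonneg_fun_def)
qed

lemma U_bounds:
  "AE z in N. U m z \<le> \<xi> \<and> U (Suc m) z \<le> U m z \<and> ennreal (U (Suc m) z) = T (U m) z \<and> g z \<le> U m z"
proof (induction m)
  case 0
  have le: "AE z in N. U 0 z \<le> \<xi>"
    using g_le by eventually_elim simp
  show ?case
    using le integral_bound[OF U_nonneg_fun le] AE_space
  proof eventually_elim
    case (elim z)
    have "T (U 0) z \<le> ennreal (g z) + ennreal (\<xi> - \<beta>)"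
      unfolding T_def using elim(2) by (intro add_left_mono) auto
    also have "\<dots> = ennreal (U 0 z)"
      using \<beta>_le_\<xi> g_nonneg[OF elim(3)] by (simp flip: ennreal_plus add: algebra_simps)
    finally have *: "T (U 0) z \<le> ennreal (U 0 z)" .
    then have fin: "T (U 0) z < top"
      by (rule order.strict_trans1) simp
    have "U (Suc 0) z \<le> enn2real (ennreal (U 0 z))"
      unfolding U.simps(2) using * by (intro enn2real_mono) auto
    then have "U (Suc 0) z \<le> U 0 z"
      using nonneg_funD(2)[OF U_nonneg_fun elim(3), of 0] by (simp del: U.simps)
    then show ?case using elim fin \<beta>_le_\<xi> by simp
  qed
next
  case (Suc m)
  have le: "AE z in N. U (Suc m) z \<le> U m z" using Suc by eventually_elim simp
  have T: "T (U (Suc m)) z \<le> T (U m) z" for z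
    by (rule T_mono[OF U_nonneg_fun U_nonneg_fun le])
  show ?case
    using Suc AE_space
  proof eventually_elim
    case (elim z)
    have "T (U (Suc m)) z \<le> ennreal (U (Suc m) z)"
      using elim(1) T[of z] by simp
    then have fin: "T (U (Suc m)) z < top"
      by (rule order.strict_trans1) simp
    have "U (Suc (Suc m)) z \<le> enn2real (ennreal (U (Suc m) z))"
      unfolding U.simps(2)[of "Suc m"] using \<open>T (U (Suc m)) z \<le> ennreal (U (Suc m) z)\<close>
      by (intro enn2real_mono) auto
    then have 1: "U (Suc (Suc m)) z \<le> U (Suc m) z"
      using nonneg_funD(2)[OF U_nonneg_fun elim(2), of "Suc m"] by (simp del: U.simps)
    have "ennreal (g z) \<le> ennreal (U (Suc m) z)"
      using elim(1) by (simp add: T_def)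
    then have "g z \<le> U (Suc m) z"
      using nonneg_funD(2)[OF U_nonneg_fun elim(2), of "Suc m"] by (simp del: U.simps add: ennreal_le_iff)
    with 1 fin elim(1) show ?case by (simp add: order.trans)
  qed
qed

lemma U_all:
  "AE z in N. \<forall>m. U m z \<le> \<xi> \<and> U (Suc m) z \<le> U m z \<and> ennreal (U (Suc m) z) = T (U m) z \<and> g z \<le> U m z"
  unfolding AE_all_countable using U_bounds by blast

lemma u_nonneg_fun: "nonneg_fun u"
proof -
  have "bdd_below (range (\<lambda>m. U m z))" if "z \<in> space N" for z
    using nonneg_funD(2)[OF U_nonneg_fun that] by (intro bdd_belowI[of _ 0]) auto
  moreover have "U m \<in> borel_measurable N" for m
    by (rule nonneg_funD[OF U_nonneg_fun])
  ultimately have "(\<lambda>z. INF m. U m z) \<in> borel_measurable N"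
    by (intro borel_measurable_cINF) auto
  then show ?thesis
    unfolding nonneg_fun_def u_def[abs_def]
    by (auto intro!: cINF_greatest nonneg_funD(2)[OF U_nonneg_fun])
qed

lemma u_le_U: "z \<in> space N \<Longrightarrow> u z \<le> U m z"
  unfolding u_def
  by (rule cINF_lower) (auto intro!: bdd_belowI[of _ 0] nonneg_funD(2)[OF U_nonneg_fun])

lemma U_tendsto: "AE z in N. (\<lambda>m. U m z) \<longlonglongrightarrow> u z"
  using U_all AE_space
proof eventually_elim
  case (elim z)
  have "decseq (\<lambda>m. U m z)" using elim by (simp add: decseq_Suc_iff)
  moreover have "bdd_below (range (\<lambda>m. U m z))"
    by (auto intro!: bdd_belowI[of _ 0] nonneg_funD(2)[OF U_nonneg_fun elim(2)])
  ultimately show ?case unfolding u_def by (intro LIMSEQ_decseq_INF)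
qed

lemma u_fixpoint: "AE z in N. ennreal (u z) = T u z"
  using U_all U_tendsto kernel_mass AE_space
proof eventually_elim
  case (elim z)
  note z [measurable] = elim(4)
  note [measurable] = G_comp_measurable[OF U_nonneg_fun] G_comp_measurable[OF u_nonneg_fun]
  have "(\<lambda>m. \<integral>\<^sup>+w. \<kappa> (z, w) * ennreal (G (U m w)) \<partial>N)
      \<longlonglongrightarrow> (\<integral>\<^sup>+w. \<kappa> (z, w) * ennreal (G (u w)) \<partial>N)"
  proof (rule nn_integral_dominated_convergence)
    have "(\<integral>\<^sup>+w. \<kappa> (z, w) * ennreal (G \<xi>) \<partial>N) = (\<integral>\<^sup>+w. \<kappa> (z, w) \<partial>N) * ennreal (G \<xi>)"
      by (intro nn_integral_multc) measurable
    also have "\<dots> \<le> 1 * ennreal (G \<xi>)" by (intro mult_right_mono elim) auto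
    finally show "(\<integral>\<^sup>+w. \<kappa> (z, w) * ennreal (G \<xi>) \<partial>N) < \<infinity>"
      by (simp add: order.strict_trans1)
    show "AE w in N. \<kappa> (z, w) * ennreal (G (U m w)) \<le> \<kappa> (z, w) * ennreal (G \<xi>)" for m
      using U_all AE_space
      by eventually_elim
        (auto intro!: mult_left_mono ennreal_leI mono_onD[OF G_mono] nonneg_funD(2)[OF U_nonneg_fun] \<xi>_nonneg)
    have fin: "AE w in N. \<kappa> (z, w) \<noteq> \<infinity>"
      by (rule nn_integral_PInf_AE) (use elim(3) in \<open>auto simp: top_unique\<close>)
    show "AE w in N. (\<lambda>m. \<kappa> (z, w) * ennreal (G (U m w))) \<longlonglongrightarrow> \<kappa> (z, w) * ennreal (G (u w))"
      using U_tendsto fin AE_space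
    proof eventually_elim
      case (elim w)
      have "(\<lambda>m. G (U m w)) \<longlonglongrightarrow> G (u w)"
        by (rule continuous_on_tendsto_compose[OF G_cont elim(1)])
          (auto simp: nonneg_funD(2)[OF U_nonneg_fun elim(3)] nonneg_funD(2)[OF u_nonneg_fun elim(3)])
      then show ?case
        using elim(2) by (intro tendsto_mult_ennreal tendsto_const tendsto_ennrealI) auto
    qed
  qed measurable
  then have "(\<lambda>m. T (U m) z) \<longlonglongrightarrow> T u z"
    unfolding T_def by (intro tendsto_add tendsto_const)
  moreover have "(\<lambda>m. T (U m) z) = (\<lambda>m. ennreal (U (Suc m) z))"
    using elim(1) by auto
  moreover have "(\<lambda>m. ennreal (U (Suc m) z)) \<longlonglongrightarrow> ennreal (u z)"
    using elim(2) by (intro tendsto_ennrealI LIMSEQ_Suc)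
  ultimately show ?case using LIMSEQ_unique by metis
qed


text \<open>Geometric convergence when \<open>g\<close> is bounded below on a set \<open>S\<close> that is closed under the dependence
  expressed by \<open>\<kappa>\<close> and that carries at least the mass \<open>d\<close> of the kernel for almost all points outside.\<close>

lemma geometric_rate:
  fixes S :: "'b set" and \<beta>\<^sub>0 d :: real
  assumes concave: "concave_on {0..} G" and "0 < \<xi>"
    and S [measurable]: "S \<in> sets N"
    and \<beta>\<^sub>0: "0 < \<beta>\<^sub>0" "0 < G \<beta>\<^sub>0" "AE z in N. z \<in> S \<longrightarrow> \<beta>\<^sub>0 \<le> g z"
    and causal: "\<And>z w. z \<in> S \<Longrightarrow> w \<in> space N - S \<Longrightarrow> \<kappa> (z, w) = 0"
    and d: "0 < d" "AE z in N. z \<notin> S \<longrightarrow> ennreal d \<le> (\<integral>\<^sup>+w. \<kappa> (z, w) * indicator S w \<partial>N)"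
  shows "\<exists>C>0. \<exists>k\<in>{0<..<1}. AE z in N. \<forall>m. 0 \<le> U m z - u z \<and> U m z - u z \<le> C * k ^ m"
proof -
  \<comment> \<open>On \<open>S\<close> the term \<open>g\<close> is at least the fraction \<open>c\<close> of each iterate; outside \<open>S\<close> the integral over \<open>S\<close> is
    at least the fraction \<open>\<delta>\<close>, on which the relative error is only half as large.\<close>
  define c \<delta> where "c = \<beta>\<^sub>0 / \<xi>" and "\<delta> = d * G \<beta>\<^sub>0 / \<xi>"
  define k where "k = max (1/2) (max (1 - c) (1 - \<delta> / 2))"
  define e :: "'b \<Rightarrow> real" where "e = (\<lambda>z. if z \<in> S then 1/2 else 1)"
  have pos: "0 < c" "0 < \<delta>" using assms by (auto simp: c_def \<delta>_def)
  have k: "k \<in> {0<..<1}" and kc: "1 - c \<le> k" and k\<delta>: "1 - \<delta> / 2 \<le> k"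
    using pos by (auto simp: k_def)
  have e: "0 \<le> e z" "e z \<le> 1" for z by (auto simp: e_def)
  have [measurable]: "e \<in> borel_measurable N" unfolding e_def by measurable
  note [measurable] = G_comp_measurable[OF U_nonneg_fun] G_comp_measurable[OF u_nonneg_fun]
  have half: "ennreal (1/2) * ennreal r = ennreal (1/2 * r)" for r
    by (rule ennreal_mult'[symmetric]) simp
  \<comment> \<open>Concavity transfers a relative error \<open>\<epsilon>\<close> from the argument of \<open>G\<close> to its value; for \<open>\<epsilon> > 1\<close> the claim is trivial.\<close>
  have G_step: "G y \<le> G x + \<epsilon> * G y" if "0 \<le> x" "0 \<le> y" "0 \<le> \<epsilon>" "y \<le> x + \<epsilon> * y" for x y \<epsilon>
  proof (cases "\<epsilon> \<le> 1")
    case True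
    have "(1 - \<epsilon>) * G y \<le> (1 - \<epsilon>) * G y + \<epsilon> * G 0"
      using that(3) G_nonneg[of 0] by simp
    also have "\<dots> \<le> G ((1 - \<epsilon>) *\<^sub>R y + \<epsilon> *\<^sub>R 0)"
      using concave_onD[OF concave, of \<epsilon> y 0] True that by simp
    also have "\<dots> \<le> G x"
      using that True mult_left_le_one_le[of y \<epsilon>]
      by (intro mono_onD[OF G_mono]) (auto simp: algebra_simps)
    finally show ?thesis by (simp add: algebra_simps)
  next
    case False
    then have "1 * G y \<le> \<epsilon> * G y" using G_nonneg[OF that(2)] by (intro mult_right_mono) auto
    then show ?thesis using G_nonneg[OF that(1)] by simp
  qed
  have step: "AE z in N. U m z \<le> u z + 2 * k ^ m * e z * U m z" for m
  proof (induction m)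
    case 0
    show ?case using AE_space
      by eventually_elim
        (use nonneg_funD(2)[OF U_nonneg_fun, of _ 0] nonneg_funD(2)[OF u_nonneg_fun] in
          \<open>auto simp: e_def simp del: U.simps intro: add_increasing\<close>)
  next
    case (Suc m)
    let ?\<epsilon> = "2 * k ^ m"
    have \<epsilon>: "0 \<le> ?\<epsilon>" using k by simp
    show ?case
      using U_all u_fixpoint kernel_mass d(2) \<beta>\<^sub>0(3) AE_space
    proof eventually_elim
      case (elim z)
      note z [measurable] = elim(6)
      define A where "A = (\<integral>\<^sup>+w. \<kappa> (z, w) * ennreal (G (U m w)) \<partial>N)"
      define B where "B = (\<integral>\<^sup>+w. \<kappa> (z, w) * ennreal (G (u w)) \<partial>N)"
      define E where "E = (\<integral>\<^sup>+w. \<kappa> (z, w) * ennreal (e w * G (U m w)) \<partial>N)"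
      have A: "ennreal (U (Suc m) z) = ennreal (g z) + A"
        using elim(1) by (simp add: A_def T_def del: U.simps)
      have B: "ennreal (u z) = ennreal (g z) + B"
        using elim(2) by (simp add: B_def T_def)
      have "A \<le> (\<integral>\<^sup>+w. \<kappa> (z, w) * ennreal (G (u w)) + ennreal ?\<epsilon> * (\<kappa> (z, w) * ennreal (e w * G (U m w))) \<partial>N)"
        unfolding A_def
      proof (rule nn_integral_mono_AE, use Suc AE_space in eventually_elim)
        case (elim w)
        have nn: "0 \<le> u w" "0 \<le> U m w" using elim nonneg_funD(2) u_nonneg_fun U_nonneg_fun by blast+
        have "G (U m w) \<le> G (u w) + ?\<epsilon> * e w * G (U m w)"
          using elim(1) \<epsilon> e nn by (intro G_step) auto
        then have "ennreal (G (U m w)) \<le> ennreal (G (u w)) + ennreal ?\<epsilon> * ennreal (e w * G (U m w))"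
          using \<epsilon> e[of w] G_nonneg nn
          by (simp flip: ennreal_plus ennreal_mult add: ennreal_leI mult.assoc)
        then have "\<kappa> (z, w) * ennreal (G (U m w))
            \<le> \<kappa> (z, w) * (ennreal (G (u w)) + ennreal ?\<epsilon> * ennreal (e w * G (U m w)))"
          by (rule mult_left_mono) simp
        then show ?case by (simp add: distrib_left mult_ac)
      qed
      also have "\<dots> = B + ennreal ?\<epsilon> * E"
        unfolding B_def E_def by (simp add: nn_integral_add nn_integral_cmult)
      finally have AB: "A \<le> B + ennreal ?\<epsilon> * E" .
      have EA: "E \<le> A"
        unfolding E_def A_def
      proof (intro nn_integral_mono mult_left_mono ennreal_leI)
        fix w assume "w \<in> space N"
        then show "e w * G (U m w) \<le> G (U m w)"
          using e[of w] G_nonneg[OF nonneg_funD(2)[OF U_nonneg_fun]] by (intro mult_left_le_one_le) auto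
      qed simp
      have "A < top" "B < top"
        using A B by (metis ennreal_less_top ennreal_add_eq_top less_top)+
      with EA have "E < top" by simp
      obtain a where a: "A = ennreal a" "0 \<le> a" using \<open>A < top\<close> by (cases A) auto
      obtain b where b: "B = ennreal b" "0 \<le> b" using \<open>B < top\<close> by (cases B) auto
      obtain E' where E': "E = ennreal E'" "0 \<le> E'" using \<open>E < top\<close> by (cases E) auto
      have g0: "0 \<le> g z" using g_nonneg z .
      have Ua: "U (Suc m) z = g z + a"
        using A nonneg_funD(2)[OF U_nonneg_fun z, of "Suc m"] g0 a
        by (simp flip: ennreal_plus del: U.simps)
      have ub: "u z = g z + b"
        using B nonneg_funD(2)[OF u_nonneg_fun z] g0 b by (simp flip: ennreal_plus)
      have ab: "a \<le> b + ?\<epsilon> * E'"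
        using AB \<epsilon> a b E' by (simp flip: ennreal_plus ennreal_mult)
      have U\<xi>: "U (Suc m) z \<le> \<xi>" using elim(1) by blast
      have U0: "0 \<le> U (Suc m) z" using nonneg_funD(2)[OF U_nonneg_fun z] .
      \<comment> \<open>\<open>E'\<close> is the propagated error up to the factor \<open>2 * k ^ m\<close>.\<close>
      have key: "E' \<le> k * e z * U (Suc m) z"
      proof (cases "z \<in> S")
        case True
        have "E = (\<integral>\<^sup>+w. ennreal (1/2) * (\<kappa> (z, w) * ennreal (G (U m w))) \<partial>N)"
          unfolding E_def
        proof (intro nn_integral_cong)
          fix w assume w: "w \<in> space N"
          show "\<kappa> (z, w) * ennreal (e w * G (U m w)) = ennreal (1/2) * (\<kappa> (z, w) * ennreal (G (U m w)))"
          proof (cases "w \<in> S")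
            case True
            then show ?thesis
              unfolding e_def by (simp only: half[symmetric] if_True mult_ac)
          qed (use causal[OF True] w in simp)
        qed
        also have "\<dots> = ennreal (1/2) * A"
          unfolding A_def by (rule nn_integral_cmult) measurable
        also have "\<dots> = ennreal (1/2 * a)"
          unfolding a(1) by (rule half)
        finally have "E' = a / 2"
          using a E' by simp
        moreover have "a \<le> (1 - c) * U (Suc m) z"
        proof -
          have "c * U (Suc m) z \<le> c * \<xi>" using pos U\<xi> by (intro mult_left_mono) auto
          also have "\<dots> \<le> g z" using elim(5) True \<open>0 < \<xi>\<close> by (simp add: c_def)
          finally show ?thesis using Ua by (simp add: algebra_simps del: U.simps)
        qed
        moreover have "(1 - c) * U (Suc m) z \<le> k * U (Suc m) z"
          by (rule mult_right_mono[OF kc U0])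
        ultimately show ?thesis using True by (simp add: e_def del: U.simps)
      next
        case False
        define D where "D = (\<integral>\<^sup>+w. \<kappa> (z, w) * ennreal (G (U m w)) * indicator S w \<partial>N)"
        have "A = (\<integral>\<^sup>+w. \<kappa> (z, w) * ennreal (e w * G (U m w))
            + ennreal (1/2) * (\<kappa> (z, w) * ennreal (G (U m w)) * indicator S w) \<partial>N)"
          unfolding A_def
        proof (intro nn_integral_cong)
          fix w assume w: "w \<in> space N"
          show "\<kappa> (z, w) * ennreal (G (U m w)) = \<kappa> (z, w) * ennreal (e w * G (U m w))
            + ennreal (1/2) * (\<kappa> (z, w) * ennreal (G (U m w)) * indicator S w)"
          proof (cases "w \<in> S")
            case True
            have "ennreal (G (U m w)) = ennreal (1/2 * G (U m w)) + ennreal (1/2) * ennreal (G (U m w))"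
              using G_nonneg[OF nonneg_funD(2)[OF U_nonneg_fun w], of m]
              unfolding half by (simp flip: ennreal_plus)
            then have "\<kappa> (z, w) * ennreal (G (U m w))
                = \<kappa> (z, w) * (ennreal (1/2 * G (U m w)) + ennreal (1/2) * ennreal (G (U m w)))" by simp
            then show ?thesis using True by (simp add: e_def distrib_left mult_ac)
          qed (simp add: e_def)
        qed
        also have "\<dots> = E + ennreal (1/2) * D"
          unfolding E_def D_def by (simp add: nn_integral_add nn_integral_cmult)
        finally have AE: "A = E + ennreal (1/2) * D" .
        have "ennreal d * ennreal (G \<beta>\<^sub>0) \<le> (\<integral>\<^sup>+w. \<kappa> (z, w) * indicator S w \<partial>N) * ennreal (G \<beta>\<^sub>0)"
          using elim(4) False by (intro mult_right_mono) auto
        also have "\<dots> = (\<integral>\<^sup>+w. \<kappa> (z, w) * indicator S w * ennreal (G \<beta>\<^sub>0) \<partial>N)"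
          by (intro nn_integral_multc[symmetric]) measurable
        also have "\<dots> \<le> D"
          unfolding D_def
        proof (rule nn_integral_mono_AE, use U_all \<beta>\<^sub>0(3) in eventually_elim)
          case (elim w)
          show ?case
          proof (cases "w \<in> S")
            case True
            have "G \<beta>\<^sub>0 \<le> G (U m w)"
              using elim True \<beta>\<^sub>0(1) by (intro mono_onD[OF G_mono]) (auto intro: order.trans less_imp_le)
            then show ?thesis using True by (auto intro!: mult_left_mono ennreal_leI)
          qed simp
        qed
        finally have "E + ennreal (1/2) * (ennreal d * ennreal (G \<beta>\<^sub>0)) \<le> A"
          unfolding AE by (intro add_left_mono mult_left_mono) auto
        moreover have "ennreal (1/2) * (ennreal d * ennreal (G \<beta>\<^sub>0)) = ennreal (1/2 * (d * G \<beta>\<^sub>0))"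
          unfolding half[symmetric] using d(1) \<beta>\<^sub>0(2) by (simp add: ennreal_mult)
        ultimately have "E' + d * G \<beta>\<^sub>0 / 2 \<le> a"
          using a E' d(1) \<beta>\<^sub>0(2) by (simp flip: ennreal_plus)
        then have "E' \<le> U (Suc m) z - \<delta> / 2 * \<xi>"
          using Ua g0 \<open>0 < \<xi>\<close> by (simp add: \<delta>_def del: U.simps)
        also have "\<dots> \<le> (1 - \<delta> / 2) * U (Suc m) z"
          using mult_left_mono[OF U\<xi>, of "\<delta> / 2"] pos by (simp add: algebra_simps del: U.simps)
        also have "\<dots> \<le> k * U (Suc m) z"
          by (rule mult_right_mono[OF k\<delta> U0])
        finally show ?thesis using False by (simp add: e_def del: U.simps)
      qed
      have "U (Suc m) z \<le> u z + ?\<epsilon> * E'" using Ua ub ab by simp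
      also have "\<dots> \<le> u z + ?\<epsilon> * (k * e z * U (Suc m) z)"
        by (intro add_left_mono mult_left_mono key \<epsilon>)
      finally show ?case by (simp add: mult_ac del: U.simps)
    qed
  qed
  have steps: "AE z in N. \<forall>m. U m z \<le> u z + 2 * k ^ m * e z * U m z"
    unfolding AE_all_countable using step by blast
  have "AE z in N. \<forall>m. 0 \<le> U m z - u z \<and> U m z - u z \<le> 2 * \<xi> * k ^ m"
    using U_all steps AE_space
  proof eventually_elim
    case (elim z)
    show ?case
    proof
      fix m
      have "U m z \<le> u z + 2 * k ^ m * e z * U m z" using elim by blast
      moreover have "2 * k ^ m * e z * U m z \<le> 2 * k ^ m * 1 * \<xi>"
        using elim k e[of z] nonneg_funD(2)[OF U_nonneg_fun elim(3), of m]
        by (intro mult_mono) auto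
      ultimately show "0 \<le> U m z - u z \<and> U m z - u z \<le> 2 * \<xi> * k ^ m"
        using u_le_U[OF elim(3), of m] by (simp add: mult_ac)
    qed
  qed
  then show ?thesis using k \<open>0 < \<xi>\<close> by (intro exI[of _ "2 * \<xi>"] conjI bexI[of _ k]) auto
qed

end

section \<open>Borel regularisation in the time variable\<close>

text \<open>The exceptional set does not depend on the first coordinate, because a null set can be discarded
  for each of the countably many rectangles that generate a given set.\<close>

lemma completion_second_factor_regularize:
  fixes f :: "'a \<times> 'b \<Rightarrow> ennreal"
  assumes "f \<in> borel_measurable (A \<Otimes>\<^sub>M completion B)"
  shows "\<exists>Z\<in>null_sets B. (\<lambda>z. f z * indicator (- Z) (snd z)) \<in> borel_measurable (A \<Otimes>\<^sub>M B)"
proof -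
  let ?R = "\<lambda>f Z. (\<lambda>z. f z * indicator (- Z) (snd z)) :: 'a \<times> 'b \<Rightarrow> ennreal"
  have mono: "?R f Z' \<in> borel_measurable (A \<Otimes>\<^sub>M B)"
    if f: "?R f Z \<in> borel_measurable (A \<Otimes>\<^sub>M B)" and [measurable]: "Z' \<in> sets B" and "Z \<subseteq> Z'"
    for f :: "'a \<times> 'b \<Rightarrow> ennreal" and Z Z'
  proof -
    have [measurable]: "(\<lambda>z. indicator (- Z') (snd z) :: ennreal) \<in> borel_measurable (A \<Otimes>\<^sub>M B)"
      by (rule measurable_cong[THEN iffD1, of _ "\<lambda>z. indicator (space B - Z') (snd z)"])
        (auto simp: space_pair_measure indicator_def, measurable)
    have "(\<lambda>z. ?R f Z z * indicator (- Z') (snd z)) \<in> borel_measurable (A \<Otimes>\<^sub>M B)"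
      using f by measurable
    also have "(\<lambda>z. ?R f Z z * indicator (- Z') (snd z)) = ?R f Z'"
      using \<open>Z \<subseteq> Z'\<close> by (auto simp: indicator_def fun_eq_iff)
    finally show ?thesis .
  qed
  show ?thesis
    using assms
  proof (induction rule: borel_measurable_induct)
    case (cong f g)
    have "?R f Z \<in> borel_measurable (A \<Otimes>\<^sub>M B) \<longleftrightarrow> ?R g Z \<in> borel_measurable (A \<Otimes>\<^sub>M B)" for Z
      by (rule measurable_cong) (use cong(3) in \<open>simp add: space_pair_measure\<close>)
    then show ?case using cong(4) by auto
  next
    case (set E)
    have "\<exists>Z\<in>null_sets B. E \<inter> (UNIV \<times> - Z) \<in> sets (A \<Otimes>\<^sub>M B)"
      using set unfolding sets_pair_measure[of A "completion B"]
    proof (induction rule: sigma_sets.induct)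
      case (Basic a)
      then obtain P Q where a: "a = P \<times> Q" "P \<in> sets A" "Q \<in> sets (completion B)" by auto
      obtain S Z Z' where Q: "Q = S \<union> Z" "Z \<subseteq> Z'" "Z' \<in> null_sets B" "S \<in> sets B"
        using a(3) by (rule sets_completionE)
      have "a \<inter> (UNIV \<times> - Z') = P \<times> (S - Z')" using a Q by auto
      also have "\<dots> \<in> sets (A \<Otimes>\<^sub>M B)" using a Q by auto
      finally show ?case using Q by blast
    next
      case Empty
      show ?case by (auto intro!: bexI[of _ "{}"])
    next
      case (Compl a)
      then obtain Z where Z: "Z \<in> null_sets B" "a \<inter> (UNIV \<times> - Z) \<in> sets (A \<Otimes>\<^sub>M B)" by blast
      have "(space A \<times> space (completion B) - a) \<inter> (UNIV \<times> - Z)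
          = (space A \<times> (space B - Z)) - (a \<inter> (UNIV \<times> - Z))" by auto
      also have "\<dots> \<in> sets (A \<Otimes>\<^sub>M B)" using Z by auto
      finally show ?case using Z by blast
    next
      case (Union a)
      then obtain Z where Z: "\<And>i. Z i \<in> null_sets B" "\<And>i. a i \<inter> (UNIV \<times> - Z i) \<in> sets (A \<Otimes>\<^sub>M B)"
        by metis
      have UZ: "(\<Union>i::nat. Z i) \<in> null_sets B" using Z by auto
      have "(\<Union>i. a i) \<inter> (UNIV \<times> - (\<Union>i. Z i))
          = (\<Union>i. a i \<inter> (UNIV \<times> - Z i)) - (space A \<times> (\<Union>i. Z i))"
        using Z(2)[THEN sets.sets_into_space] by (fastforce simp: space_pair_measure)
      also have "\<dots> \<in> sets (A \<Otimes>\<^sub>M B)" using Z UZ by auto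
      finally show ?case using UZ by blast
    qed
    then obtain Z where Z: "Z \<in> null_sets B" "E \<inter> (UNIV \<times> - Z) \<in> sets (A \<Otimes>\<^sub>M B)" by blast
    have "?R (indicator E) Z = indicator (E \<inter> (UNIV \<times> - Z))" by (auto simp: indicator_def)
    then show ?case using Z by (intro bexI[of _ Z]) auto
  next
    case (mult f c)
    then obtain Z where Z: "Z \<in> null_sets B" "?R f Z \<in> borel_measurable (A \<Otimes>\<^sub>M B)" by blast
    then have "(\<lambda>z. c * ?R f Z z) \<in> borel_measurable (A \<Otimes>\<^sub>M B)" by measurable
    then show ?case using Z(1) by (auto simp: mult.assoc)
  next
    case (add f g)
    then obtain Z Y where Z: "Z \<in> null_sets B" "?R f Z \<in> borel_measurable (A \<Otimes>\<^sub>M B)"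
      and Y: "Y \<in> null_sets B" "?R g Y \<in> borel_measurable (A \<Otimes>\<^sub>M B)" by blast
    have ZY: "Z \<union> Y \<in> null_sets B" using Z Y by auto
    have "?R f (Z \<union> Y) \<in> borel_measurable (A \<Otimes>\<^sub>M B)"
      by (rule mono[OF Z(2)]) (use ZY in auto)
    moreover have "?R g (Z \<union> Y) \<in> borel_measurable (A \<Otimes>\<^sub>M B)"
      by (rule mono[OF Y(2)]) (use ZY in auto)
    ultimately have "(\<lambda>z. ?R g (Z \<union> Y) z + ?R f (Z \<union> Y) z) \<in> borel_measurable (A \<Otimes>\<^sub>M B)"
      by measurable
    then show ?case by (intro bexI[OF _ ZY]) (simp only: distrib_right)
  next
    case (seq F)
    then obtain Z where Z: "\<And>i. Z i \<in> null_sets B" "\<And>i. ?R (F i) (Z i) \<in> borel_measurable (A \<Otimes>\<^sub>M B)"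
      by metis
    have UZ: "(\<Union>i::nat. Z i) \<in> null_sets B" using Z by auto
    have "?R (F i) (\<Union>i. Z i) \<in> borel_measurable (A \<Otimes>\<^sub>M B)" for i
      using UZ by (intro mono[OF Z(2)[of i]]) auto
    then have "(\<lambda>z. SUP i. ?R (F i) (\<Union>i. Z i) z) \<in> borel_measurable (A \<Otimes>\<^sub>M B)" by measurable
    also have "(\<lambda>z. SUP i. ?R (F i) (\<Union>i. Z i) z) = ?R (SUP i. F i) (\<Union>i. Z i)"
      by (auto simp: fun_eq_iff SUP_mult_right_ennreal image_comp)
    finally show ?case using UZ by blast
  qed
qed

section \<open>Lebesgue measure on the positive half-line\<close>

lemma sigma_finite_completion:
  assumes "sigma_finite_measure M"
  shows "sigma_finite_measure (completion M)"
proof -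
  interpret sigma_finite_measure M by fact
  obtain A where "countable A" "A \<subseteq> sets M" "\<Union>A = space M" "\<forall>a\<in>A. emeasure M a \<noteq> \<infinity>"
    using sigma_finite_countable by blast
  then show ?thesis by (intro sigma_finite_measure.intro exI[of _ A]) auto
qed

lemma sigma_finite_Rpos: "sigma_finite_measure Rpos"
  unfolding Rpos_def
  by (intro sigma_finite_measure_restrict_space sigma_finite_completion sigma_finite_lborel) auto

lemma space_Rpos [simp]: "space Rpos = {0<..}"
  by (simp add: Rpos_def)

lemma sets_Rpos: "S \<in> sets borel \<Longrightarrow> S \<subseteq> {0<..} \<Longrightarrow> S \<in> sets Rpos"
  by (auto simp: Rpos_def sets_restrict_space)

lemma id_measurable_Rpos [measurable]: "(\<lambda>t. t) \<in> measurable Rpos borel"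
  unfolding Rpos_def by (rule measurable_restrict_space1) (auto intro: measurable_completion)

lemma nn_integral_Rpos: "(\<integral>\<^sup>+t. f t \<partial>Rpos) = (\<integral>\<^sup>+t\<in>{0<..}. f t \<partial>lebesgue)"
  unfolding Rpos_def by (rule nn_integral_restrict_space) auto

lemma AE_Rpos_iff: "(AE t in Rpos. P t) \<longleftrightarrow> (AE t in lborel. 0 < t \<longrightarrow> P t)"
  unfolding Rpos_def by (subst AE_restrict_space_iff) (auto simp: AE_completion_iff)

lemma AE_reflect:
  fixes t :: real
  assumes "AE \<tau> in lborel. P \<tau>"
  shows "AE s in lborel. P (t - s)"
proof -
  obtain Z where Z: "Z \<in> null_sets lborel" "{\<tau>. \<not> P \<tau>} \<subseteq> Z"
    using assms unfolding eventually_ae_filter by auto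
  have [measurable]: "Z \<in> sets borel" using Z by auto
  have "AE s in lborel. t + (-1) * s \<notin> Z"
    by (rule AE_borel_affine) (use Z in \<open>auto intro: AE_not_in\<close>)
  then show ?thesis by eventually_elim (use Z(2) in auto)
qed

lemma AE_pair_fst:
  assumes "sigma_finite_measure N" "AE x in M. P x"
  shows "AE z in M \<Otimes>\<^sub>M N. P (fst z)"
proof -
  interpret sigma_finite_measure N by fact
  obtain Z where Z: "Z \<in> null_sets M" "{x\<in>space M. \<not> P x} \<subseteq> Z"
    using assms(2) unfolding eventually_ae_filter by auto
  have "Z \<times> space N \<in> null_sets (M \<Otimes>\<^sub>M N)"
    using Z by auto
  then show ?thesis
    by (rule AE_I') (use Z(2) in \<open>auto simp: space_pair_measure\<close>)
qed

section \<open>The convolution kernel\<close>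

lemma kernel_regularize:
  assumes [measurable]: "K \<in> borel_measurable (M \<Otimes>\<^sub>M M \<Otimes>\<^sub>M Rpos)"
  shows "\<exists>Z\<in>null_sets lborel. (\<lambda>(x, y, \<tau>). ennreal (K (x, y, \<tau>)) * indicator ({0<..} - Z) \<tau>)
    \<in> borel_measurable (M \<Otimes>\<^sub>M M \<Otimes>\<^sub>M borel)"
proof -
  \<comment> \<open>The value at non-positive times is irrelevant; mapping them to \<open>1\<close> extends \<open>K\<close> to the whole line.\<close>
  have clamp [measurable]: "(\<lambda>t::real. if 0 < t then t else 1) \<in> measurable lebesgue Rpos"
    unfolding Rpos_def
  proof (rule measurable_restrict_space2)
    show "(\<lambda>t::real. if 0 < t then t else 1) \<in> measurable lebesgue lebesgue"
      by (rule measurable_If) (auto simp flip: greaterThan_def)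
  qed auto
  define f where "f = (\<lambda>p. ennreal (K (fst (fst p), snd (fst p), if 0 < snd p then snd p else 1)))"
  have "f \<in> borel_measurable ((M \<Otimes>\<^sub>M M) \<Otimes>\<^sub>M lebesgue)"
    unfolding f_def using measurable_compose[OF measurable_snd clamp] by measurable
  then obtain Z where Z: "Z \<in> null_sets lborel"
    and f [measurable]: "(\<lambda>z. f z * indicator (- Z) (snd z)) \<in> borel_measurable ((M \<Otimes>\<^sub>M M) \<Otimes>\<^sub>M lborel)"
    using completion_second_factor_regularize by blast
  have assoc: "(\<lambda>p. ((fst p, fst (snd p)), snd (snd p)))
      \<in> measurable (M \<Otimes>\<^sub>M M \<Otimes>\<^sub>M borel) ((M \<Otimes>\<^sub>M M) \<Otimes>\<^sub>M lborel)"
    by measurable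
  have "(\<lambda>p. f ((fst p, fst (snd p)), snd (snd p)) * indicator (- Z) (snd (snd p)) * indicator {0<..} (snd (snd p)))
      \<in> borel_measurable (M \<Otimes>\<^sub>M M \<Otimes>\<^sub>M borel)"
    using measurable_compose[OF assoc f] unfolding snd_conv by (rule borel_measurable_times_ennreal) measurable
  also have "(\<lambda>p. f ((fst p, fst (snd p)), snd (snd p)) * indicator (- Z) (snd (snd p)) * indicator {0<..} (snd (snd p)))
      = (\<lambda>(x, y, \<tau>). ennreal (K (x, y, \<tau>)) * indicator ({0<..} - Z) \<tau>)"
    by (rule ext) (simp add: f_def indicator_def split_beta)
  finally show ?thesis using Z by blast
qed

text \<open>\<open>Z\<close> is a null set of times off which \<open>K\<close> is Borel in the time variable.\<close>

locale volterra_kernel = M: sigma_finite_measure M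
  for M :: "'a measure" +
  fixes K :: "'a \<times> 'a \<times> real \<Rightarrow> real" and Z :: "real set"
  assumes K_measurable [measurable]: "K \<in> borel_measurable (M \<Otimes>\<^sub>M M \<Otimes>\<^sub>M Rpos)"
    and K_nonneg: "\<And>x y \<tau>. x \<in> space M \<Longrightarrow> y \<in> space M \<Longrightarrow> 0 < \<tau> \<Longrightarrow> 0 \<le> K (x, y, \<tau>)"
    and K_mass: "AE (x, t) in M \<Otimes>\<^sub>M Rpos. (\<integral>y. K (x, y, t) \<partial>M) = 1"
    and Z: "Z \<in> null_sets lborel"
    and K_borel: "(\<lambda>(x, y, \<tau>). ennreal (K (x, y, \<tau>)) * indicator ({0<..} - Z) \<tau>)
      \<in> borel_measurable (M \<Otimes>\<^sub>M M \<Otimes>\<^sub>M borel)"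
begin

sublocale Rpos: sigma_finite_measure Rpos
  by (rule sigma_finite_Rpos)

sublocale MR: pair_sigma_finite M Rpos ..

text \<open>The kernel of the causal convolution on \<open>M \<Otimes>\<^sub>M Rpos\<close>, with \<open>K\<close> replaced by its Borel version; the
  indicator also cuts off \<open>s \<ge> t\<close>.\<close>

definition kernel :: "('a \<times> real) \<times> ('a \<times> real) \<Rightarrow> ennreal" where
  "kernel = (\<lambda>((x, t), (y, s)). ennreal (K (x, y, t - s)) * indicator ({0<..} - Z) (t - s))"

lemma kernel_measurable [measurable]: "kernel \<in> borel_measurable ((M \<Otimes>\<^sub>M Rpos) \<Otimes>\<^sub>M (M \<Otimes>\<^sub>M Rpos))"
proof -
  have "(\<lambda>p. (fst (fst p), fst (snd p), snd (fst p) - snd (snd p)))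
      \<in> measurable ((M \<Otimes>\<^sub>M Rpos) \<Otimes>\<^sub>M (M \<Otimes>\<^sub>M Rpos)) (M \<Otimes>\<^sub>M M \<Otimes>\<^sub>M borel)"
    by measurable
  from measurable_compose[OF this K_borel] show ?thesis
    by (simp add: kernel_def split_beta')
qed

lemma convolution_eq_nn_integral:
  assumes [measurable]: "w \<in> borel_measurable (M \<Otimes>\<^sub>M Rpos)" and x: "x \<in> space M" and "0 < t"
  shows "(\<integral>\<^sup>+s\<in>{0<..<t}. (\<integral>\<^sup>+y. ennreal (K (x, y, t - s)) * w (y, s) \<partial>M) \<partial>lebesgue)
    = (\<integral>\<^sup>+z. kernel ((x, t), z) * w z \<partial>(M \<Otimes>\<^sub>M Rpos))"
proof -
  have [measurable]: "(x, t) \<in> space (M \<Otimes>\<^sub>M Rpos)"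
    using x \<open>0 < t\<close> by (simp add: space_pair_measure)
  have "AE \<tau> in lborel. \<tau> \<notin> Z" using Z by (rule AE_not_in)
  then have notin: "AE s in lebesgue. t - s \<notin> Z"
    by (intro AE_completion AE_reflect)
  have "(\<integral>\<^sup>+z. kernel ((x, t), z) * w z \<partial>(M \<Otimes>\<^sub>M Rpos)) = (\<integral>\<^sup>+s. (\<integral>\<^sup>+y. kernel ((x, t), (y, s)) * w (y, s) \<partial>M) \<partial>Rpos)"
    by (rule MR.nn_integral_snd[symmetric]) measurable
  also have "\<dots> = (\<integral>\<^sup>+s\<in>{0<..}. (\<integral>\<^sup>+y. kernel ((x, t), (y, s)) * w (y, s) \<partial>M) \<partial>lebesgue)"
    by (rule nn_integral_Rpos)
  also have "\<dots> = (\<integral>\<^sup>+s\<in>{0<..<t}. (\<integral>\<^sup>+y. ennreal (K (x, y, t - s)) * w (y, s) \<partial>M) \<partial>lebesgue)"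
    using notin by (intro nn_integral_cong_AE, eventually_elim) (auto simp: kernel_def indicator_def)
  finally show ?thesis ..
qed

text \<open>On functions of time alone the convolution is integration up to the current time, because \<open>K\<close> has
  mass \<open>1\<close> in space. The exceptional null set is the same for all integrands \<open>f\<close>.\<close>

lemma kernel_time_integral:
  "AE z in M \<Otimes>\<^sub>M Rpos. \<forall>f\<in>borel_measurable Rpos.
     (\<integral>\<^sup>+w. kernel (z, w) * f (snd w) \<partial>(M \<Otimes>\<^sub>M Rpos)) = (\<integral>\<^sup>+s\<in>{0<..<snd z}. f s \<partial>lebesgue)"
proof -
  have "AE x in M. AE t in Rpos. (\<integral>y. K (x, y, t) \<partial>M) = 1"
    using MR.AE_pair[OF K_mass] by simp
  then have "AE z in M \<Otimes>\<^sub>M Rpos. AE t in Rpos. (\<integral>y. K (fst z, y, t) \<partial>M) = 1"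
    by (rule AE_pair_fst[OF sigma_finite_Rpos])
  then show ?thesis
    using AE_space
  proof eventually_elim
    case (elim z)
    obtain x t where z: "z = (x, t)" by (cases z)
    have x [measurable]: "x \<in> space M" and "0 < t" using elim(2) by (auto simp: z space_pair_measure)
    have sec: "(\<lambda>y. K (x, y, \<tau>)) \<in> borel_measurable M" if "0 < \<tau>" for \<tau>
    proof -
      have "(\<lambda>y. (x, y, \<tau>)) \<in> measurable M (M \<Otimes>\<^sub>M M \<Otimes>\<^sub>M Rpos)"
        using x that by (intro measurable_Pair measurable_const) auto
      from measurable_compose[OF this K_measurable] show ?thesis by simp
    qed
    have "AE \<tau> in lborel. 0 < \<tau> \<longrightarrow> (\<integral>y. K (x, y, \<tau>) \<partial>M) = 1"
      using elim(1) by (simp add: z AE_Rpos_iff)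
    then have "AE \<tau> in lborel. 0 < \<tau> \<longrightarrow> (\<integral>\<^sup>+y. ennreal (K (x, y, \<tau>)) \<partial>M) = 1"
    proof eventually_elim
      case (elim \<tau>)
      show ?case
      proof
        assume "0 < \<tau>"
        then have 1: "(\<integral>y. K (x, y, \<tau>) \<partial>M) = 1" using elim by blast
        \<comment> \<open>The Bochner integral of a non-integrable function is \<open>0\<close>.\<close>
        then have "integrable M (\<lambda>y. K (x, y, \<tau>))"
          by (rule contrapos_pp[of "_ = 1"]) (simp add: not_integrable_integral_eq)
        then show "(\<integral>\<^sup>+y. ennreal (K (x, y, \<tau>)) \<partial>M) = 1"
          using 1 K_nonneg[OF x _ \<open>0 < \<tau>\<close>] by (subst nn_integral_eq_integral) auto
      qed
    qed
    then have mass: "AE s in lebesgue. 0 < t - s \<longrightarrow> (\<integral>\<^sup>+y. ennreal (K (x, y, t - s)) \<partial>M) = 1"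
      by (intro AE_completion AE_reflect)
    show ?case
    proof
      fix f :: "real \<Rightarrow> ennreal" assume [measurable]: "f \<in> borel_measurable Rpos"
      have "(\<integral>\<^sup>+w. kernel (z, w) * f (snd w) \<partial>(M \<Otimes>\<^sub>M Rpos))
          = (\<integral>\<^sup>+s\<in>{0<..<t}. (\<integral>\<^sup>+y. ennreal (K (x, y, t - s)) * f (snd (y, s)) \<partial>M) \<partial>lebesgue)"
        unfolding z by (rule convolution_eq_nn_integral[symmetric, OF _ x \<open>0 < t\<close>]) measurable
      also have "\<dots> = (\<integral>\<^sup>+s\<in>{0<..<t}. f s \<partial>lebesgue)"
      proof (rule nn_integral_cong_AE, use mass in eventually_elim)
        case (elim s)
        show ?case
        proof (cases "s \<in> {0<..<t}")
          case True
          then show ?thesis using elim sec[of "t - s"] by (simp add: nn_integral_multc)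
        qed simp
      qed
      finally show "(\<integral>\<^sup>+w. kernel (z, w) * f (snd w) \<partial>(M \<Otimes>\<^sub>M Rpos)) = (\<integral>\<^sup>+s\<in>{0<..<snd z}. f s \<partial>lebesgue)"
        by (simp add: z)
    qed
  qed
qed

end

section \<open>The Volterra equation\<close>

theorem theorem3p1:
  fixes M :: "'a measure"
    and K :: "'a \<times> 'a \<times> real \<Rightarrow> real"
    and g h :: "'a \<times> real \<Rightarrow> real"
    and G p1 p2 :: "real \<Rightarrow> real"
    and \<beta> \<xi> :: real
  assumes M: "sigma_finite_measure M"
    and K_meas: "K \<in> borel_measurable (M \<Otimes>\<^sub>M M \<Otimes>\<^sub>M Rpos)"
    and K_nonneg: "\<forall>z \<in> space (M \<Otimes>\<^sub>M M \<Otimes>\<^sub>M Rpos). 0 \<le> K z"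
    and K_int: "AE (x, t) in M \<Otimes>\<^sub>M Rpos. (\<integral>y. K (x, y, t) \<partial>M) = 1"
    and g: "g \<in> Linf_nonneg (M \<Otimes>\<^sub>M Rpos)"
    and \<beta>: "\<beta> = enn2real (Linf_norm (M \<Otimes>\<^sub>M Rpos) g)"
    and h_meas: "h \<in> borel_measurable (M \<Otimes>\<^sub>M Rpos)"
    and h_nonneg: "\<forall>z \<in> space (M \<Otimes>\<^sub>M Rpos). 0 \<le> h z"
    and G_maps: "G \<in> {0..} \<rightarrow> {0..}"
    and G_cont: "continuous_on {0..} G"
    and G_mono: "strict_mono_on {0..} G"
    and G_concave: "concave_on {0..} G"
    and G_0: "G 0 = 0"
    and p1: "continuous_on {0<..} p1" "p1 \<in> {0<..} \<rightarrow> {0<..}"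
    and p2: "continuous_on {0<..} p2" "p2 \<in> {0<..} \<rightarrow> {0<..}"
    and \<xi>: "\<xi> > 0"
    and a: "\<exists>t>0. p1 t \<noteq> p2 t" "(\<integral>t. p2 t \<partial>Rpos) = 1"
    and b: "AE (x, t) in M \<Otimes>\<^sub>M Rpos. p1 t \<le> h (x, t) \<and> h (x, t) \<le> p2 t"
    and c: "\<xi> - G \<xi> = \<beta>"
  shows "\<exists>u \<in> Linf_nonneg (M \<Otimes>\<^sub>M Rpos). \<exists>U :: nat \<Rightarrow> 'a \<times> real \<Rightarrow> real.
    (AE (x, t) in M \<Otimes>\<^sub>M Rpos. ennreal (u (x, t)) = volterra_rhs M K h G g u x t) \<and>
    (\<forall>m. U m \<in> borel_measurable (M \<Otimes>\<^sub>M Rpos) \<and> (\<forall>z \<in> space (M \<Otimes>\<^sub>M Rpos). 0 \<le> U m z)) \<and>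
    (\<forall>z \<in> space (M \<Otimes>\<^sub>M Rpos). U 0 z = \<xi> - \<beta> + g z) \<and>
    (\<forall>m. AE (x, t) in M \<Otimes>\<^sub>M Rpos.
       ennreal (U (Suc m) (x, t)) = volterra_rhs M K h G g (U m) x t) \<and>
    (AE z in M \<Otimes>\<^sub>M Rpos. \<forall>m\<ge>1. U (Suc m) z \<le> U m z) \<and>
    (AE z in M \<Otimes>\<^sub>M Rpos. (\<lambda>m. U m z) \<longlonglongrightarrow> u z) \<and>
    ((\<exists>T0>0. (INF z \<in> space M \<times> {0<..<T0}. g z) > 0) \<and>
     (\<exists>L>0. ((\<lambda>t. p1 t / p2 t) \<longlongrightarrow> L) (at_right 0)) \<and>
     (\<exists>\<phi> \<psi>. homeomorphism {0..1} {0..1} \<phi> \<psi> \<and> concave_on {0..1} \<phi> \<and>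
        \<phi> 0 = 0 \<and> \<phi> 1 = 1 \<and>
        (\<forall>\<sigma>\<in>{0..1}. \<forall>v\<in>{0..\<xi>}. G (\<sigma> * v) \<ge> \<phi> \<sigma> * G v))
     \<longrightarrow> (\<exists>C>0. \<exists>k\<in>{0<..<1}. AE z in M \<Otimes>\<^sub>M Rpos.
            \<forall>m\<ge>1. 0 \<le> U (Suc m) z - u z \<and> U (Suc m) z - u z \<le> C * k ^ m))"
proof -
  let ?N = "M \<Otimes>\<^sub>M Rpos"
  obtain Z where Z: "Z \<in> null_sets lborel"
    and K_borel: "(\<lambda>(x, y, \<tau>). ennreal (K (x, y, \<tau>)) * indicator ({0<..} - Z) \<tau>)
      \<in> borel_measurable (M \<Otimes>\<^sub>M M \<Otimes>\<^sub>M borel)"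
    using kernel_regularize[OF K_meas] by blast
  interpret M: sigma_finite_measure M by (rule M)
  interpret V: volterra_kernel M K Z
    using K_meas K_nonneg K_int Z K_borel
    by unfold_locales (auto simp: space_pair_measure)
  have p_meas: "p1 \<in> borel_measurable Rpos" "p2 \<in> borel_measurable Rpos"
    unfolding Rpos_def using p1(1) p2(1)
    by (auto intro!: continuous_imp_measurable_on_sets_lebesgue)
  note [measurable] = h_meas p_meas V.kernel_measurable
  have p_pos: "0 < p1 t" "0 < p2 t" if "0 < t" for t
    using p1(2) p2(2) that by auto
  have h0: "0 \<le> h z" if "z \<in> space ?N" for z using h_nonneg that by blast
  have G_nonneg: "0 \<le> G v" if "0 \<le> v" for v using G_maps that by auto
  have g_meas [measurable]: "g \<in> borel_measurable ?N" and g0: "\<And>z. z \<in> space ?N \<Longrightarrow> 0 \<le> g z"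
    and g_fin: "Linf_norm ?N g < \<infinity>"
    using g by (auto simp: Linf_nonneg_def)
  have p2_int: "(\<integral>\<^sup>+t. ennreal (p2 t) \<partial>Rpos) = 1"
  proof -
    have "integrable Rpos p2"
      using a(2) by (rule contrapos_pp[of "_ = 1"]) (simp add: not_integrable_integral_eq)
    then show ?thesis
      using a(2) p_pos by (subst nn_integral_eq_integral) (auto intro!: AE_I2 less_imp_le)
  qed

  define \<kappa> where "\<kappa> = (\<lambda>p. V.kernel p * ennreal (h (snd p)))"
  interpret H: hammerstein ?N \<kappa> g G \<beta> \<xi>
  proof
    show "\<kappa> \<in> borel_measurable (?N \<Otimes>\<^sub>M ?N)" unfolding \<kappa>_def by measurable
    show "AE z in ?N. g z \<le> \<beta>"
      using esssup_AE[where M = ?N and f = "\<lambda>z. ennreal \<bar>g z\<bar>"]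
    proof eventually_elim
      case (elim z)
      then have "ennreal \<bar>g z\<bar> \<le> ennreal \<beta>"
        using g_fin by (simp add: \<beta> Linf_norm_def)
      then have "\<bar>g z\<bar> \<le> \<beta>"
        by (subst (asm) ennreal_le_iff) (simp_all add: \<beta>)
      then show ?case by simp
    qed
    show "AE z in ?N. (\<integral>\<^sup>+w. \<kappa> (z, w) \<partial>?N) \<le> 1"
      using V.kernel_time_integral
    proof eventually_elim
      case (elim z)
      have "(\<integral>\<^sup>+w. \<kappa> (z, w) \<partial>?N) \<le> (\<integral>\<^sup>+w. V.kernel (z, w) * ennreal (p2 (snd w)) \<partial>?N)"
        by (rule nn_integral_mono_AE, use b in eventually_elim)
          (auto simp: \<kappa>_def intro!: mult_left_mono ennreal_leI)
      also have "\<dots> = (\<integral>\<^sup>+s\<in>{0<..<snd z}. ennreal (p2 s) \<partial>lebesgue)"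
        by (rule bspec[OF elim]) measurable
      also have "\<dots> \<le> (\<integral>\<^sup>+s\<in>{0<..}. ennreal (p2 s) \<partial>lebesgue)"
        by (intro nn_integral_mono) (auto simp: indicator_def)
      also have "\<dots> = 1" using p2_int by (simp add: nn_integral_Rpos)
      finally show ?case .
    qed
    show "mono_on {0..} G" using G_mono by (rule strict_mono_on_imp_mono_on)
  qed (use g0 G_nonneg G_cont \<xi> c in auto)

  have rhs: "volterra_rhs M K h G g v x t = H.T v (x, t)"
    if v: "H.nonneg_fun v" and x: "x \<in> space M" and t: "0 < t" for v x t
  proof -
    note [measurable] = H.G_comp_measurable[OF v]
    have "(\<integral>\<^sup>+s\<in>{0<..<t}. (\<integral>\<^sup>+y. ennreal (K (x, y, t - s) * h (y, s) * G (v (y, s))) \<partial>M) \<partial>lebesgue)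
        = (\<integral>\<^sup>+s\<in>{0<..<t}. (\<integral>\<^sup>+y. ennreal (K (x, y, t - s)) * (ennreal (h (y, s)) * ennreal (G (v (y, s)))) \<partial>M) \<partial>lebesgue)"
    proof (intro nn_integral_cong)
      fix s
      show "(\<integral>\<^sup>+y. ennreal (K (x, y, t - s) * h (y, s) * G (v (y, s))) \<partial>M) * indicator {0<..<t} s
          = (\<integral>\<^sup>+y. ennreal (K (x, y, t - s)) * (ennreal (h (y, s)) * ennreal (G (v (y, s)))) \<partial>M) * indicator {0<..<t} s"
      proof (cases "s \<in> {0<..<t}")
        case True
        have "ennreal (K (x, y, t - s) * h (y, s) * G (v (y, s)))
            = ennreal (K (x, y, t - s)) * (ennreal (h (y, s)) * ennreal (G (v (y, s))))"
          if "y \<in> space M" for y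
        proof -
          have ys: "(y, s) \<in> space ?N" using that True by (simp add: space_pair_measure)
          show ?thesis
            using V.K_nonneg[OF x that, of "t - s"] True h0[OF ys] G_nonneg[OF H.nonneg_funD(2)[OF v ys]]
            by (simp add: ennreal_mult mult.assoc)
        qed
        then show ?thesis by (simp cong: nn_integral_cong)
      qed simp
    qed
    also have "\<dots> = (\<integral>\<^sup>+w. V.kernel ((x, t), w) * (ennreal (h w) * ennreal (G (v w))) \<partial>?N)"
      using V.convolution_eq_nn_integral[OF _ x t, of "\<lambda>w. ennreal (h w) * ennreal (G (v w))"] by simp
    also have "\<dots> = (\<integral>\<^sup>+w. \<kappa> ((x, t), w) * ennreal (G (v w)) \<partial>?N)"
      by (simp add: \<kappa>_def mult.assoc)
    finally show ?thesis
      unfolding volterra_rhs_def H.T_def by (rule arg_cong)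
  qed
  have rhs_AE: "AE (x, t) in ?N. ennreal (v (x, t)) = volterra_rhs M K h G g w x t"
    if "H.nonneg_fun w" "AE z in ?N. ennreal (v z) = H.T w z" for v w
    using that(2) AE_space
  proof eventually_elim
    case (elim z)
    then show ?case using rhs[OF that(1)] by (auto simp: space_pair_measure split: prod.split)
  qed

  have u_bdd: "H.u \<in> Linf_nonneg ?N"
  proof -
    have [measurable]: "H.u \<in> borel_measurable ?N" by (rule H.nonneg_funD[OF H.u_nonneg_fun])
    have "AE z in ?N. ennreal \<bar>H.u z\<bar> \<le> ennreal \<xi>"
      using H.U_all AE_space
    proof eventually_elim
      case (elim z)
      have "H.u z \<le> \<xi>" using H.u_le_U[OF elim(2)] elim(1) by (meson order.trans)
      then show ?case using H.nonneg_funD(2)[OF H.u_nonneg_fun elim(2)] by (simp add: ennreal_leI)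
    qed
    then have "Linf_norm ?N H.u \<le> ennreal \<xi>"
      unfolding Linf_norm_def by (intro esssup_I) measurable
    also have "\<dots> < \<infinity>" by simp
    finally show ?thesis
      using H.nonneg_funD[OF H.u_nonneg_fun] by (auto simp: Linf_nonneg_def)
  qed

  have rate: "\<exists>C>0. \<exists>k\<in>{0<..<1}. AE z in ?N. \<forall>m\<ge>1. 0 \<le> H.U (Suc m) z - H.u z \<and> H.U (Suc m) z - H.u z \<le> C * k ^ m"
    if "0 < T0" and inf: "(INF z \<in> space M \<times> {0<..<T0}. g z) > 0" for T0
  proof -
    define \<beta>\<^sub>0 where "\<beta>\<^sub>0 = (INF z \<in> space M \<times> {0<..<T0}. g z)"
    define P where "P = (\<integral>\<^sup>+s\<in>{0<..<T0}. ennreal (p1 s) \<partial>lebesgue)"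
    \<comment> \<open>\<open>P\<close> could be infinite when \<open>M\<close> is a null measure, as \<open>p1\<close> is then not bounded by \<open>p2\<close>.\<close>
    define d where "d = enn2real (min 1 P)"
    define S where "S = space M \<times> {0<..<T0}"
    have T0_meas: "{0<..<T0} \<in> sets Rpos" by (rule sets_Rpos) auto
    have g_ge: "\<beta>\<^sub>0 \<le> g z" if "z \<in> S" for z
      unfolding \<beta>\<^sub>0_def using that g0
      by (intro cINF_lower bdd_belowI2[of _ 0]) (auto simp: S_def space_pair_measure)
    have P_Rpos: "P = (\<integral>\<^sup>+s. ennreal (p1 s) * indicator {0<..<T0} s \<partial>Rpos)"
      unfolding P_def nn_integral_Rpos by (intro nn_integral_cong) (auto simp: indicator_def)
    have "P \<noteq> 0"
    proof
      assume "P = 0"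
      then have "AE s in Rpos. ennreal (p1 s) * indicator {0<..<T0} s = 0"
        unfolding P_Rpos by (subst (asm) nn_integral_0_iff_AE) (use T0_meas in measurable)
      then have "AE s in Rpos. s \<notin> {0<..<T0}"
        using AE_space
      proof eventually_elim
        case (elim s)
        then have "ennreal (p1 s) \<noteq> 0" using p_pos(1)[of s] by (simp add: ennreal_eq_0_iff not_le)
        then show ?case using elim(1) by (auto simp: indicator_def)
      qed
      then have "AE s in lborel. s \<notin> {0<..<T0}"
        unfolding AE_Rpos_iff by eventually_elim auto
      then have "{0<..<T0} \<in> null_sets lborel" 
        by (subst (asm) AE_iff_null) (auto simp: greaterThanLessThan_def greaterThan_def lessThan_def Int_def)
      then show False using \<open>0 < T0\<close> by auto
    qed
    have d: "0 < d" "ennreal d \<le> P"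
    proof -
      have "min 1 P \<noteq> top" by (auto simp: min_def)
      then have eq: "ennreal d = min 1 P"
        unfolding d_def by (intro ennreal_enn2real) (simp add: less_top)
      then have "ennreal d \<noteq> 0" using \<open>P \<noteq> 0\<close> by (auto simp: min_def)
      then show "0 < d" by (simp add: ennreal_eq_0_iff not_le)
      show "ennreal d \<le> P" unfolding eq by simp
    qed
    have "\<exists>C>0. \<exists>k\<in>{0<..<1}. AE z in ?N. \<forall>m. 0 \<le> H.U m z - H.u z \<and> H.U m z - H.u z \<le> C * k ^ m"
    proof (rule H.geometric_rate[of S \<beta>\<^sub>0 d])
      show "concave_on {0..} G" "0 < \<xi>" "0 < d" by fact+
      show S: "S \<in> sets ?N" unfolding S_def using T0_meas by auto
      show "0 < \<beta>\<^sub>0" using inf by (simp add: \<beta>\<^sub>0_def)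
      then show "0 < G \<beta>\<^sub>0" using strict_mono_onD[OF G_mono, of 0 \<beta>\<^sub>0] G_0 by simp
      show "AE z in ?N. z \<in> S \<longrightarrow> \<beta>\<^sub>0 \<le> g z" using g_ge by simp
      show "\<kappa> (z, w) = 0" if "z \<in> S" "w \<in> space ?N - S" for z w
        using that by (auto simp: S_def \<kappa>_def V.kernel_def space_pair_measure indicator_def split: prod.splits if_splits)
      show "AE z in ?N. z \<notin> S \<longrightarrow> ennreal d \<le> (\<integral>\<^sup>+w. \<kappa> (z, w) * indicator S w \<partial>?N)"
        using V.kernel_time_integral AE_space
      proof eventually_elim
        case (elim z)
        show ?case
        proof
          assume "z \<notin> S"
          then have t: "T0 \<le> snd z" using elim(2) by (auto simp: S_def space_pair_measure)
          have f [measurable]: "(\<lambda>s. ennreal (p1 s) * indicator {0<..<T0} s) \<in> borel_measurable Rpos"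
            using T0_meas by measurable
          have "ennreal d \<le> P" by (rule d)
          also have "P = (\<integral>\<^sup>+s\<in>{0<..<snd z}. (ennreal (p1 s) * indicator {0<..<T0} s) \<partial>lebesgue)"
            unfolding P_def using t by (intro nn_integral_cong) (auto simp: indicator_def)
          also have "\<dots> = (\<integral>\<^sup>+w. V.kernel (z, w) * (ennreal (p1 (snd w)) * indicator {0<..<T0} (snd w)) \<partial>?N)"
            by (rule bspec[OF elim(1) f, symmetric])
          also have "\<dots> \<le> (\<integral>\<^sup>+w. \<kappa> (z, w) * indicator S w \<partial>?N)"
          proof (rule nn_integral_mono_AE, use b AE_space in eventually_elim)
            case (elim w)
            show ?case
            proof (cases "w \<in> S")
              case True
              then have "snd w \<in> {0<..<T0}" by (auto simp: S_def)
              moreover have "ennreal (p1 (snd w)) \<le> ennreal (h w)"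
                using elim(1) by (auto intro: ennreal_leI)
              ultimately show ?thesis using True by (simp add: \<kappa>_def mult_left_mono)
            next
              case False
              then have "snd w \<notin> {0<..<T0}" using elim(2) by (auto simp: S_def space_pair_measure)
              then show ?thesis by simp
            qed
          qed
          finally show "ennreal d \<le> (\<integral>\<^sup>+w. \<kappa> (z, w) * indicator S w \<partial>?N)" .
        qed
      qed
    qed
    then obtain C k where C: "0 < C" and k: "k \<in> {0<..<1}"
      and *: "AE z in ?N. \<forall>m. 0 \<le> H.U m z - H.u z \<and> H.U m z - H.u z \<le> C * k ^ m" by blast
    from * have "AE z in ?N. \<forall>m\<ge>1. 0 \<le> H.U (Suc m) z - H.u z \<and> H.U (Suc m) z - H.u z \<le> C * k ^ m"
    proof eventually_elim
      case (elim z)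
      have "C * k ^ Suc m \<le> C * k ^ m" for m
        using C k by (intro mult_left_mono power_Suc_le_self) auto
      then show ?case using elim by (meson order.trans)
    qed
    then show ?thesis using C k by blast
  qed

  show ?thesis
  proof (intro bexI[of _ H.u] exI[of _ H.U] conjI)
    show "AE (x, t) in ?N. ennreal (H.u (x, t)) = volterra_rhs M K h G g H.u x t"
      by (rule rhs_AE[OF H.u_nonneg_fun H.u_fixpoint])
    show "\<forall>m. AE (x, t) in ?N. ennreal (H.U (Suc m) (x, t)) = volterra_rhs M K h G g (H.U m) x t"
    proof
      fix m
      have "AE z in ?N. ennreal (H.U (Suc m) z) = H.T (H.U m) z"
        using H.U_all by eventually_elim blast
      then show "AE (x, t) in ?N. ennreal (H.U (Suc m) (x, t)) = volterra_rhs M K h G g (H.U m) x t"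
        by (rule rhs_AE[OF H.U_nonneg_fun])
    qed
    show "AE z in ?N. \<forall>m\<ge>1. H.U (Suc m) z \<le> H.U m z"
      using H.U_all by eventually_elim blast
  qed (use u_bdd rate H.U_tendsto H.U_nonneg_fun in \<open>auto simp: H.nonneg_fun_def simp del: H.U.simps(2)\<close>)
qed

end
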